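(* Let $m,n\ge 1$ be integers, and let $X_1,\ldots,X_m$ and $Y_1,\ldots,Y_n$ be independent random samples from absolutely continuous univariate distribution functions $F$ and $G$, respectively. For any integers $0\le s<m$ and $0\le r<n$, the joint probability mass function of $A_s$ and $B_r$ under $H_0: F(x)=G(x)$ (for all $x$) is given by $$P(A_s=k,\,B_r=i)=\frac{\binom{s+k}{s}\binom{r+i}{r}}{\binom{m+n}{n}}\binom{m+n-s-r-i-k-2}{n-r-k-1}$$ for integers $0\le i\le m-s-1$ and $0\le k\le n-r-1$; $$P(A_s=k,\,B_r=i)=\frac{\binom{m+n-r-i-1}{n-r-1}\binom{m+n-s-k-1}{m-s-1}}{\binom{m+n}{n}}\binom{k+i-m-n+s+r}{k-n+r}$$ for integers $m-s\le i\le m$ and $n-r\le k\le n$; and $P(A_s=k,\,B_r=i)=0$ otherwise.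
   Context: $X_{(1)}\le\dots\le X_{(m)}$ and $Y_{(1)}\le\dots\le Y_{(n)}$ denote the order statistics of the two samples. For $0\le s<m$ and $0\le r<n$, the exceedance statistic $A_s$ is the number of $Y$-observations larger than $X_{(m-s)}$, and the precedence statistic $B_r$ is the number of $X$-observations smaller than $Y_{(1+r)}$. The two samples are independent of each other and the observations within each sample are i.i.d. *)

theory Defs
  imports "HOL-Probability.Probability"
begin

text \<open>
  A random sample \<open>X\<^sub>1, \<dots>, X\<^sub>m\<close> from the distribution function \<open>F\<close>.
  Measurability of each \<open>X\<^sub>j\<close> is part of \<^const>\<open>prob_space.indep_vars\<close>.
\<close>

definition random_sample ::
    "'a measure \<Rightarrow> nat \<Rightarrow> (nat \<Rightarrow> 'a \<Rightarrow> real) \<Rightarrow> (real \<Rightarrow> real) \<Rightarrow> bool" where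
  "random_sample M m X F \<longleftrightarrow>
     prob_space.indep_vars M (\<lambda>_. borel) X {1..m} \<and>
     (\<forall>j\<in>{1..m}. \<forall>x. cdf (distr M borel (X j)) x = F x)"

text \<open>The random vectors \<open>(X\<^sub>1, \<dots>, X\<^sub>m)\<close> and \<open>(Y\<^sub>1, \<dots>, Y\<^sub>n)\<close> are independent.\<close>

definition samples_indep ::
    "'a measure \<Rightarrow> nat \<Rightarrow> (nat \<Rightarrow> 'a \<Rightarrow> real) \<Rightarrow> nat \<Rightarrow> (nat \<Rightarrow> 'a \<Rightarrow> real) \<Rightarrow> bool" where
  "samples_indep M m X n Y \<longleftrightarrow>
     prob_space.indep_var M
       (\<Pi>\<^sub>M j\<in>{1..m}. borel) (\<lambda>\<omega>. \<lambda>j\<in>{1..m}. X j \<omega>)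
       (\<Pi>\<^sub>M j\<in>{1..n}. borel) (\<lambda>\<omega>. \<lambda>j\<in>{1..n}. Y j \<omega>)"

text \<open>
  Absolute continuity in the sense usual for distribution functions: \<open>F\<close> is the integral of
  a probability density. (\<^const>\<open>absolutely_continuous\<close> is a relation between measures.)
\<close>

definition abs_continuous_df :: "(real \<Rightarrow> real) \<Rightarrow> bool" where
  "abs_continuous_df F \<longleftrightarrow>
     (\<exists>f :: real \<Rightarrow> real. (\<forall>t. f t \<ge> 0) \<and> integrable lborel f \<and>
        (\<forall>x. F x = (LBINT t:{..x}. f t)))"

text \<open>The \<open>j\<close>-th order statistic \<open>X\<^sub>(\<^sub>j\<^sub>)\<close> of \<open>X\<^sub>1, \<dots>, X\<^sub>m\<close>, meaningful for \<open>1 \<le> j \<le> m\<close>.\<close>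

definition order_stat :: "nat \<Rightarrow> (nat \<Rightarrow> 'a \<Rightarrow> real) \<Rightarrow> nat \<Rightarrow> 'a \<Rightarrow> real" where
  "order_stat m X j \<omega> = sort (map (\<lambda>l. X l \<omega>) [1..<Suc m]) ! (j - 1)"

definition exceedance ::
    "nat \<Rightarrow> (nat \<Rightarrow> 'a \<Rightarrow> real) \<Rightarrow> nat \<Rightarrow> (nat \<Rightarrow> 'a \<Rightarrow> real) \<Rightarrow> nat \<Rightarrow> 'a \<Rightarrow> nat" where
  "exceedance m X n Y s \<omega> = card {j \<in> {1..n}. Y j \<omega> > order_stat m X (m - s) \<omega>}"

definition precedence ::
    "nat \<Rightarrow> (nat \<Rightarrow> 'a \<Rightarrow> real) \<Rightarrow> nat \<Rightarrow> (nat \<Rightarrow> 'a \<Rightarrow> real) \<Rightarrow> nat \<Rightarrow> 'a \<Rightarrow> nat" where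
  "precedence m X n Y r \<omega> = card {j \<in> {1..m}. X j \<omega> < order_stat n Y (1 + r) \<omega>}"

end

theory Submission
  imports Defs
begin

text \<open>
  Under the null hypothesis the \<open>m + n\<close> pooled observations are independent with the same law, and
  this law has no atoms because its distribution function is continuous. Hence ties have probability
  zero (\<open>AE_PiM_inj_on\<close>) and the pooled sample is exchangeable: all \<open>(m + n) choose n\<close> ways to
  choose the positions of the \<open>X\<close>-observations are equally likely. The probability of an event that
  depends on the relative order only is therefore the number of favourable subsets of positions
  divided by \<open>(m + n) choose n\<close>. This is made precise without constructing rank vectors: the
  probability is averaged over all index sets \<open>T\<close> that could carry the \<open>X\<close>-sample, and for every
  pooled sample without ties the number of favourable \<open>T\<close> is the same
  (\<open>prob_rank_event_eq_count\<close>).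

  To count the favourable subsets (\<open>card_rank_event\<close>), consider \<open>x = X\<^sub>(\<^sub>m\<^sub>-\<^sub>s\<^sub>)\<close> and
  \<open>y = Y\<^sub>(\<^sub>1\<^sub>+\<^sub>r\<^sub>)\<close>. If \<open>A\<^sub>s = k\<close> and \<open>B\<^sub>r = i\<close>, then exactly \<open>r + i\<close> pooled observations lie
  below \<open>y\<close> and exactly \<open>s + k\<close> lie above \<open>x\<close>. So \<open>k\<close> and \<open>i\<close> determine the two positions in the
  pooled order. They cut the remaining positions into three blocks, and in each block the number of
  \<open>X\<close>-observations is prescribed. This yields a product of three binomial coefficients. If \<open>y\<close>
  precedes \<open>x\<close>, then \<open>i < m - s\<close> and \<open>k < n - r\<close>, which is the first formula; if \<open>x\<close> precedes
  \<open>y\<close>, then \<open>i \<ge> m - s\<close> and \<open>k \<ge> n - r\<close>, which is the second; no other pair is possible.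
\<close>

section \<open>Ranks in a finite family without ties\<close>

lemma rank_less:
  fixes z :: "'b \<Rightarrow> 'c::linorder"
  assumes "finite I" "a \<in> I" "z a < z b"
  shows "card {l\<in>I. z l < z a} < card {l\<in>I. z l < z b}"
  using assms by (intro psubset_card_mono) auto

lemma inj_on_rank:
  fixes z :: "'b \<Rightarrow> 'c::linorder"
  assumes "finite I" "inj_on z I"
  shows "inj_on (\<lambda>a. card {l\<in>I. z l < z a}) I"
proof (rule inj_onI)
  fix a b assume ab: "a \<in> I" "b \<in> I" and eq: "card {l\<in>I. z l < z a} = card {l\<in>I. z l < z b}"
  have "\<not> z a < z b" "\<not> z b < z a"
    using rank_less[OF assms(1) ab(1), of z b] rank_less[OF assms(1) ab(2), of z a] eq by auto
  then show "a = b" using assms(2) ab by (metis inj_onD not_less_iff_gr_or_eq)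
qed

lemma ex_rank:
  fixes z :: "'b \<Rightarrow> 'c::linorder"
  assumes "finite I" "inj_on z I" "j < card I"
  shows "\<exists>a\<in>I. card {l\<in>I. z l < z a} = j"
proof -
  let ?rk = "\<lambda>a. card {l\<in>I. z l < z a}"
  have "?rk ` I \<subseteq> {..<card I}"
    using assms(1) by (auto intro!: psubset_card_mono)
  moreover have "card (?rk ` I) = card {..<card I}"
    using card_image[OF inj_on_rank[OF assms(1,2)]] by simp
  ultimately have "?rk ` I = {..<card I}"
    by (intro card_subset_eq) auto
  then show ?thesis using assms(3) by (metis (no_types, lifting) imageE lessThan_iff)
qed

lemma card_above:
  fixes z :: "'b \<Rightarrow> 'c::linorder"
  assumes "finite I" "inj_on z I" "a \<in> I"
  shows "card {l\<in>I. z l < z a} + card {l\<in>I. z a < z l} + 1 = card I"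
proof -
  have "I = insert a ({l\<in>I. z l < z a} \<union> {l\<in>I. z a < z l})"
    using assms(2,3) by (auto simp: inj_on_def) (metis linorder_neqE)
  then have "card I = card (insert a ({l\<in>I. z l < z a} \<union> {l\<in>I. z a < z l}))" by simp
  also have "\<dots> = Suc (card ({l\<in>I. z l < z a} \<union> {l\<in>I. z a < z l}))"
    using assms(1) by (subst card_insert_disjoint) auto
  also have "card ({l\<in>I. z l < z a} \<union> {l\<in>I. z a < z l}) = card {l\<in>I. z l < z a} + card {l\<in>I. z a < z l}"
    using assms(1) by (intro card_Un_disjoint) auto
  finally show ?thesis by simp
qed

lemma card_split_subset:
  assumes "finite I" "T \<subseteq> I"
  shows "card {l\<in>I. P l} = card {l\<in>T. P l} + card {l\<in>I - T. P l}"
proof -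
  have "{l\<in>I. P l} = {l\<in>T. P l} \<union> {l\<in>I - T. P l}" using assms by auto
  then show ?thesis using assms finite_subset[OF assms(2,1)] by (simp add: card_Un_disjoint disjoint_iff)
qed

section \<open>The event in terms of ranks\<close>

text \<open>
  The event of interest in terms of ranks only. In a sample \<open>A\<close> without ties the order statistic
  with \<open>p\<close> observations below it is the unique \<open>x\<close> with this number of smaller observations, so
  with \<open>p = m - s - 1\<close> the four equations say that \<open>x\<close> is \<open>X\<^sub>(\<^sub>m\<^sub>-\<^sub>s\<^sub>)\<close>, that \<open>y\<close> is
  \<open>Y\<^sub>(\<^sub>1\<^sub>+\<^sub>r\<^sub>)\<close>, and that the exceedance and precedence statistics are \<open>k\<close> and \<open>i\<close>.
  Since only comparisons of values enter, and only indices carry the sample membership, the same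
  formula makes sense for every division of a pooled index set into two parts.
\<close>

definition rank_event ::
    "('b \<Rightarrow> 'c::linorder) \<Rightarrow> 'b set \<Rightarrow> 'b set \<Rightarrow> nat \<Rightarrow> nat \<Rightarrow> nat \<Rightarrow> nat \<Rightarrow> bool" where
  "rank_event z A B p r k i \<longleftrightarrow>
     (\<exists>x\<in>A. \<exists>y\<in>B. card {l\<in>A. z l < z x} = p \<and> card {l\<in>B. z l < z y} = r \<and>
        card {l\<in>B. z x < z l} = k \<and> card {l\<in>A. z l < z y} = i)"

text \<open>
  The two regimes of the mass function: \<open>y\<close> below \<open>x\<close>, where both counts are small, and
  \<open>x\<close> below \<open>y\<close>, where both are large. The strict inequality \<open>p < i\<close> comes from counting
  \<open>x\<close> itself among the elements below \<open>y\<close>; likewise \<open>y\<close> is counted in \<open>k\<close>.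
\<close>

lemma rank_event_range:
  fixes z :: "'b \<Rightarrow> 'c::linorder"
  assumes fin: "finite A" "finite B" and inj: "inj_on z (A \<union> B)" and disj: "A \<inter> B = {}"
    and ev: "rank_event z A B p r k i"
  shows "i \<le> p \<and> k + r < card B \<or> p < i \<and> i \<le> card A \<and> card B \<le> k + r \<and> k \<le> card B"
proof -
  from ev obtain x y where x: "x \<in> A" "card {l\<in>A. z l < z x} = p" "card {l\<in>B. z x < z l} = k"
    and y: "y \<in> B" "card {l\<in>B. z l < z y} = r" "card {l\<in>A. z l < z y} = i"
    unfolding rank_event_def by blast
  have B: "r + card {l\<in>B. z y < z l} + 1 = card B"
    using card_above[OF fin(2) inj_on_subset[OF inj] y(1)] y(2) by simp
  have le: "i \<le> card A" "k \<le> card B"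
    using fin by (auto simp flip: x(3) y(3) intro: card_mono)
  have "x \<noteq> y" using x(1) y(1) disj by blast
  then have "z x \<noteq> z y" using inj_onD[OF inj, of x y] x(1) y(1) by blast
  then consider "z y < z x" | "z x < z y" by (metis linorder_neqE)
  then show ?thesis
  proof cases
    case 1
    have "i \<le> p" unfolding x(2)[symmetric] y(3)[symmetric]
      using 1 fin by (intro card_mono) auto
    moreover have "k \<le> card {l\<in>B. z y < z l}" unfolding x(3)[symmetric]
      using 1 fin by (intro card_mono) auto
    ultimately show ?thesis using B by linarith
  next
    case 2
    have "p < i" unfolding x(2)[symmetric] y(3)[symmetric]
      using rank_less[OF fin(1) x(1) 2] .
    moreover have "card (insert y {l\<in>B. z y < z l}) \<le> k" unfolding x(3)[symmetric]
      using 2 fin y(1) by (intro card_mono) auto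
    ultimately show ?thesis using B le fin by auto
  qed
qed

text \<open>
  Permuting the pooled observations amounts to placing the two samples on other index sets.
\<close>

lemma rank_event_reindex:
  assumes inj: "inj_on \<pi> (A \<union> B)" and z': "\<And>l. l \<in> A \<union> B \<Longrightarrow> z' l = z (\<pi> l)"
  shows "rank_event z' A B p r k i \<longleftrightarrow> rank_event z (\<pi> ` A) (\<pi> ` B) p r k i"
proof -
  have card: "card {l\<in>\<pi> ` C. P (z l)} = card {l\<in>C. P (z' l)}" if "C \<subseteq> A \<union> B" for C P
  proof -
    have "{l\<in>\<pi> ` C. P (z l)} = \<pi> ` {l\<in>C. P (z' l)}" using z' that by force
    moreover have "inj_on \<pi> {l\<in>C. P (z' l)}" using that by (intro inj_on_subset[OF inj]) auto
    ultimately show ?thesis by (simp add: card_image)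
  qed
  have less: "card {l\<in>\<pi> ` A. z l < c} = card {l\<in>A. z' l < c}" "card {l\<in>\<pi> ` B. z l < c} = card {l\<in>B. z' l < c}" for c
    by (intro card; simp)+
  have greater: "card {l\<in>\<pi> ` B. c < z l} = card {l\<in>B. c < z' l}" for c
    by (intro card; simp)
  have "rank_event z (\<pi> ` A) (\<pi> ` B) p r k i \<longleftrightarrow>
     (\<exists>x\<in>A. \<exists>y\<in>B. card {l\<in>A. z' l < z (\<pi> x)} = p \<and> card {l\<in>B. z' l < z (\<pi> y)} = r \<and>
        card {l\<in>B. z (\<pi> x) < z' l} = k \<and> card {l\<in>A. z' l < z (\<pi> y)} = i)"
    unfolding rank_event_def Set.bex_simps(7) less greater ..
  also have "\<dots> \<longleftrightarrow> rank_event z' A B p r k i"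
    unfolding rank_event_def using z' by (intro bex_cong refl) simp
  finally show ?thesis ..
qed

section \<open>Counting the favourable subsets\<close>

text \<open>
  A subset with prescribed trace on \<open>E\<close> is determined by its traces on the three remaining
  blocks, and these can be chosen independently.
\<close>

lemma card_subsets_by_blocks:
  assumes fin: "finite I" and I: "I = A \<union> B \<union> C \<union> E"
    and disj: "A \<inter> B = {}" "A \<inter> C = {}" "B \<inter> C = {}" "E \<inter> (A \<union> B \<union> C) = {}"
    and D: "D \<subseteq> E"
  shows "card {T. T \<subseteq> I \<and> T \<inter> E = D \<and> card (T \<inter> A) = p \<and> card (T \<inter> B) = q \<and> card (T \<inter> C) = t}
         = (card A choose p) * (card B choose q) * (card C choose t)"
proof -
  let ?S = "\<lambda>A p. {S. S \<subseteq> A \<and> card S = p}"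
  have bij: "bij_betw (\<lambda>T. (T \<inter> A, T \<inter> B, T \<inter> C))
     {T. T \<subseteq> I \<and> T \<inter> E = D \<and> card (T \<inter> A) = p \<and> card (T \<inter> B) = q \<and> card (T \<inter> C) = t}
     (?S A p \<times> ?S B q \<times> ?S C t)" (is "bij_betw ?f ?X ?Y")
  proof (rule bij_betw_byWitness[where f' = "\<lambda>(S1, S2, S3). S1 \<union> S2 \<union> S3 \<union> D"])
    show "\<forall>T\<in>?X. (case ?f T of (S1, S2, S3) \<Rightarrow> S1 \<union> S2 \<union> S3 \<union> D) = T"
      using I by auto
    have restr: "(S1 \<union> S2 \<union> S3 \<union> D) \<inter> A = S1" "(S1 \<union> S2 \<union> S3 \<union> D) \<inter> B = S2"
        "(S1 \<union> S2 \<union> S3 \<union> D) \<inter> C = S3" "(S1 \<union> S2 \<union> S3 \<union> D) \<inter> E = D"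
      if "S1 \<subseteq> A" "S2 \<subseteq> B" "S3 \<subseteq> C" for S1 S2 S3
      using that disj D by blast+
    show "\<forall>u\<in>?Y. ?f (case u of (S1, S2, S3) \<Rightarrow> S1 \<union> S2 \<union> S3 \<union> D) = u"
      by (clarsimp simp: restr)
    show "?f ` ?X \<subseteq> ?Y" by auto
    show "(\<lambda>(S1, S2, S3). S1 \<union> S2 \<union> S3 \<union> D) ` ?Y \<subseteq> ?X"
      using I D by (clarsimp simp: restr) blast
  qed
  have "finite A" "finite B" "finite C" using fin I by auto
  then show ?thesis
    using bij_betw_same_card[OF bij] by (simp add: card_cartesian_product n_subsets)
qed

lemma card_Int_Un_disjoint:
  assumes "finite T" "A \<inter> B = {}"
  shows "card (T \<inter> (A \<union> B)) = card (T \<inter> A) + card (T \<inter> B)"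
  unfolding Int_Un_distrib using assms by (intro card_Un_disjoint) auto

text \<open>
  Two fixed elements \<open>a\<close> and \<open>b\<close> cut \<open>I\<close> into the blocks below, between and above. Prescribing
  how many members of \<open>T\<close> lie below each cut, together with \<open>card T\<close>, amounts to prescribing the
  size of \<open>T\<close> in each block. The set \<open>D\<close> tells which of the two cuts belong to \<open>T\<close>; both
  orders of an \<open>X\<close>-cut and a \<open>Y\<close>-cut are thereby covered.
\<close>

lemma card_subsets_two_cuts:
  fixes z :: "'b \<Rightarrow> 'c::linorder"
  assumes fin: "finite I" and inj: "inj_on z I" and ab: "a \<in> I" "b \<in> I" "z a < z b"
    and D: "D \<subseteq> {a, b}"
  shows "card {T. T \<subseteq> I \<and> T \<inter> {a, b} = D \<and> card {l\<in>T. z l < z a} = p \<and>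
           card {l\<in>T. z l < z b} = p + card (D \<inter> {a}) + q \<and>
           card T = p + q + t + card D}
         = (card {l\<in>I. z l < z a} choose p)
           * ((card {l\<in>I. z l < z b} - card {l\<in>I. z l < z a} - 1) choose q)
           * (card {l\<in>I. z b < z l} choose t)" (is "card ?L = _")
proof -
  let ?A = "{l\<in>I. z l < z a}" and ?B = "{l\<in>I. z a < z l \<and> z l < z b}" and ?C = "{l\<in>I. z b < z l}"
  have tri: "z l < z c \<or> l = c \<or> z c < z l" if "l \<in> I" "c \<in> I" for l c
    using inj_onD[OF inj] that by (metis linorder_neqE)
  have I: "I = ?A \<union> ?B \<union> ?C \<union> {a, b}"
    using tri[OF _ ab(1)] tri[OF _ ab(2)] ab(1,2) by auto
  have disj: "?A \<inter> ?B = {}" "?A \<inter> ?C = {}" "?B \<inter> ?C = {}" "{a, b} \<inter> (?A \<union> ?B \<union> ?C) = {}"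
    using ab(3) less_trans[OF ab(3)] by (blast dest: less_not_sym less_trans)+
  have disj': "?A \<inter> {a} = {}" "(?A \<union> {a}) \<inter> ?B = {}" "(?A \<union> ?B) \<inter> ?C = {}" "(?A \<union> ?B \<union> ?C) \<inter> {a, b} = {}"
    using disj by blast+
  have low: "card {l\<in>T. z l < z b} = card (T \<inter> ?A) + card (T \<inter> {a}) + card (T \<inter> ?B)"
    and all: "card T = card (T \<inter> ?A) + card (T \<inter> ?B) + card (T \<inter> ?C) + card (T \<inter> {a, b})"
    if T: "T \<subseteq> I" for T
  proof -
    have "finite T" using T fin finite_subset by blast
    note split = card_Int_Un_disjoint[OF this]
    have "{l\<in>T. z l < z b} = T \<inter> (?A \<union> {a} \<union> ?B)"
      using T tri[OF _ ab(1)] ab(3) by auto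
    then show "card {l\<in>T. z l < z b} = card (T \<inter> ?A) + card (T \<inter> {a}) + card (T \<inter> ?B)"
      by (simp only: split[OF disj'(2)] split[OF disj'(1)])
    have "T = T \<inter> (?A \<union> ?B \<union> ?C \<union> {a, b})" using T I by blast
    then have "card T = card (T \<inter> (?A \<union> ?B \<union> ?C \<union> {a, b}))" by (rule arg_cong)
    then show "card T = card (T \<inter> ?A) + card (T \<inter> ?B) + card (T \<inter> ?C) + card (T \<inter> {a, b})"
      by (simp only: split[OF disj'(4)] split[OF disj'(3)] split[OF disj(1)])
  qed
  have "?L = {T. T \<subseteq> I \<and> T \<inter> {a, b} = D \<and> card (T \<inter> ?A) = p \<and> card (T \<inter> ?B) = q \<and> card (T \<inter> ?C) = t}"
  proof -
    have "(card {l\<in>T. z l < z a} = p \<and>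
           card {l\<in>T. z l < z b} = p + card (D \<inter> {a}) + q \<and> card T = p + q + t + card D) \<longleftrightarrow>
         (card (T \<inter> ?A) = p \<and> card (T \<inter> ?B) = q \<and> card (T \<inter> ?C) = t)"
      if T: "T \<subseteq> I" and D: "T \<inter> {a, b} = D" for T
    proof -
      have a: "{l\<in>T. z l < z a} = T \<inter> ?A" using T by auto
      have "T \<inter> {a} = D \<inter> {a}" using D by auto
      then have b: "card {l\<in>T. z l < z b} = card (T \<inter> ?A) + card (D \<inter> {a}) + card (T \<inter> ?B)"
        using low[OF T] by simp
      have c: "card T = card (T \<inter> ?A) + card (T \<inter> ?B) + card (T \<inter> ?C) + card D"
        using all[OF T] D by simp
      show ?thesis
        unfolding a b c by auto
    qed
    then show ?thesis by blast
  qed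
  moreover have "card ?B = card {l\<in>I. z l < z b} - card ?A - 1"
  proof -
    have "I \<inter> ?A = ?A" "I \<inter> {a} = {a}" "I \<inter> ?B = ?B" using ab(1) by blast+
    then show ?thesis using low[OF order_refl] by (simp only:) simp
  qed
  moreover note card_subsets_by_blocks[OF fin I disj D, of p q t]
  ultimately show ?thesis by (simp only:)
qed

text \<open>
  The reason why the count is a product of binomial coefficients: \<open>k\<close> and \<open>i\<close> fix the ranks of
  the two order statistics in the pooled sample, because \<open>r\<close> members of one part and \<open>i\<close> of the
  other precede \<open>Y\<^sub>(\<^sub>1\<^sub>+\<^sub>r\<^sub>)\<close>, while \<open>s\<close> and \<open>k\<close> follow \<open>X\<^sub>(\<^sub>m\<^sub>-\<^sub>s\<^sub>)\<close>. Hence the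
  elements \<open>x\<close> and \<open>y\<close> do not depend on \<open>T\<close>, and what remains are conditions on the number of
  members of \<open>T\<close> below two fixed cuts.
\<close>

lemma rank_event_iff_pooled_ranks:
  fixes z :: "'b \<Rightarrow> 'c::linorder"
  assumes fin: "finite I" and inj: "inj_on z I" and sr: "s < m"
    and x: "x \<in> I" "card {l\<in>I. z x < z l} = s + k"
    and y: "y \<in> I" "card {l\<in>I. z l < z y} = r + i"
    and T: "T \<subseteq> I" "card T = m"
  shows "rank_event z T (I - T) (m - s - 1) r k i \<longleftrightarrow>
    x \<in> T \<and> y \<notin> T \<and> card {l\<in>T. z l < z x} = m - s - 1 \<and> card {l\<in>T. z l < z y} = i"
proof -
  note split = card_split_subset[OF fin T(1)]
  have finT: "finite T" using T fin finite_subset by blast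
  have injT: "inj_on z T" using inj T inj_on_subset by blast
  show ?thesis
  proof
    assume "rank_event z T (I - T) (m - s - 1) r k i"
    then obtain x' y' where x': "x' \<in> T" "card {l\<in>T. z l < z x'} = m - s - 1" "card {l\<in>I - T. z x' < z l} = k"
      and y': "y' \<in> I - T" "card {l\<in>I - T. z l < z y'} = r" "card {l\<in>T. z l < z y'} = i"
      unfolding rank_event_def by blast
    have I': "x' \<in> I" "y' \<in> I" using x'(1) y'(1) T(1) by auto
    have "card {l\<in>T. z x' < z l} = s"
      using card_above[OF finT injT x'(1)] x'(2) T(2) sr by linarith
    then have "card {l\<in>I. z x' < z l} = s + k"
      using split[of "\<lambda>l. z x' < z l"] x'(3) by linarith
    then have "card {l\<in>I. z l < z x'} = card {l\<in>I. z l < z x}"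
      using card_above[OF fin inj I'(1)] card_above[OF fin inj x(1)] x(2) by linarith
    then have "x' = x" using inj_onD[OF inj_on_rank[OF fin inj] _ I'(1) x(1)] by blast
    moreover have "card {l\<in>I. z l < z y'} = card {l\<in>I. z l < z y}"
      using split[of "\<lambda>l. z l < z y'"] y(2) y'(2,3) by linarith
    then have "y' = y" using inj_onD[OF inj_on_rank[OF fin inj] _ I'(2) y(1)] by blast
    ultimately show "x \<in> T \<and> y \<notin> T \<and> card {l\<in>T. z l < z x} = m - s - 1 \<and> card {l\<in>T. z l < z y} = i"
      using x'(1,2) y'(1,3) by blast
  next
    assume R: "x \<in> T \<and> y \<notin> T \<and> card {l\<in>T. z l < z x} = m - s - 1 \<and> card {l\<in>T. z l < z y} = i"
    then have "x \<in> T" by blast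
    have "card {l\<in>T. z x < z l} = s"
      using card_above[OF finT injT \<open>x \<in> T\<close>] R T(2) sr by linarith
    then have "card {l\<in>I - T. z x < z l} = k" using split[of "\<lambda>l. z x < z l"] x(2) by linarith
    moreover have "card {l\<in>I - T. z l < z y} = r" using split[of "\<lambda>l. z l < z y"] y(2) R by linarith
    ultimately show "rank_event z T (I - T) (m - s - 1) r k i"
      unfolding rank_event_def using R y(1) by blast
  qed
qed

lemma choose_add_sym: "(p + q) choose p = (p + q) choose q"
  using binomial_symmetric[of p "p + q"] by simp

text \<open>
  In each regime the pooled ranks \<open>r + i\<close> of \<open>y\<close> and \<open>m + n - 1 - s - k\<close> of \<open>x\<close> decide which
  cut comes first, and the three blocks contribute one binomial coefficient each.
\<close>

lemma card_rank_event:
  fixes z :: "'b \<Rightarrow> 'c::linorder"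
  assumes fin: "finite I" and inj: "inj_on z I" and cI: "card I = m + n"
    and sr: "s < m" "r < n"
  shows "card {T. T \<subseteq> I \<and> card T = m \<and> rank_event z T (I - T) (m - s - 1) r k i} =
      (if i \<le> m - s - 1 \<and> k \<le> n - r - 1 then
         ((s + k) choose s) * ((r + i) choose r) * ((m + n - s - r - i - k - 2) choose (n - r - k - 1))
       else if m - s \<le> i \<and> i \<le> m \<and> n - r \<le> k \<and> k \<le> n then
         ((m + n - r - i - 1) choose (n - r - 1)) * ((m + n - s - k - 1) choose (m - s - 1))
           * ((k + i + s + r - (m + n)) choose (k + r - n))
       else 0)" (is "card ?R = _")
proof -
  let ?low = "i \<le> m - s - 1 \<and> k \<le> n - r - 1"
  let ?high = "m - s \<le> i \<and> i \<le> m \<and> n - r \<le> k \<and> k \<le> n"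
  show ?thesis
  proof (cases "?low \<or> ?high")
    case False
    have "?R = {}"
    proof (rule equals0I)
      fix T assume "T \<in> ?R"
      then have T: "T \<subseteq> I" "card T = m" "rank_event z T (I - T) (m - s - 1) r k i" by auto
      have "finite T" using T fin finite_subset by blast
      moreover have "card (I - T) = n" using T cI \<open>finite T\<close> by (simp add: card_Diff_subset)
      moreover have "inj_on z (T \<union> (I - T))" using inj T by (simp add: Un_absorb1)
      ultimately show False
        using rank_event_range[of T "I - T", OF _ _ _ _ T(3)] fin T(2) False sr by auto
    qed
    then have "card ?R = 0" by (simp only: card.empty)
    moreover have "\<not> ?low" "\<not> ?high" using False by blast+
    ultimately show ?thesis by (simp only: if_False)
  next
    case True
    then have ki: "k \<le> n" "i \<le> m" using sr by auto
    obtain x where x: "x \<in> I" "card {l\<in>I. z l < z x} = m + n - 1 - s - k"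
      using ex_rank[OF fin inj, of "m + n - 1 - s - k"] cI sr ki by auto
    obtain y where y: "y \<in> I" "card {l\<in>I. z l < z y} = r + i"
      using ex_rank[OF fin inj, of "r + i"] cI sr ki by auto
    have x': "card {l\<in>I. z x < z l} = s + k"
      using card_above[OF fin inj x(1)] cI x(2) sr ki by linarith
    have y': "card {l\<in>I. z y < z l} = m + n - 1 - r - i"
      using card_above[OF fin inj y(1)] cI y(2) sr ki by linarith
    have R: "?R = {T. T \<subseteq> I \<and> card T = m \<and> x \<in> T \<and> y \<notin> T \<and>
        card {l\<in>T. z l < z x} = m - s - 1 \<and> card {l\<in>T. z l < z y} = i}"
      using rank_event_iff_pooled_ranks[OF fin inj sr(1) x(1) x' y] by (intro Collect_cong) blast
    show ?thesis
    proof (cases ?low)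
      case low: True
      \<comment> \<open>The blocks have \<open>r + i\<close>, \<open>m + n - s - r - i - k - 2\<close> and \<open>s + k\<close> elements.\<close>
      have "\<not> z x \<le> z y"
      proof
        assume "z x \<le> z y"
        then have "card {l\<in>I. z l < z x} \<le> card {l\<in>I. z l < z y}" using fin by (intro card_mono) auto
        then show False using x(2) y(2) low sr by linarith
      qed
      then have yx: "z y < z x" by simp
      then have "y \<noteq> x" by blast
      then have lows: "i + card ({x} \<inter> {y}) + (m - s - 1 - i) = m - s - 1"
        "i + (m - s - 1 - i) + s + card {x} = m"
        and mem: "T \<inter> {y, x} = {x} \<longleftrightarrow> x \<in> T \<and> y \<notin> T" for T
        using low sr by auto
      have blocks: "?R = {T. T \<subseteq> I \<and> T \<inter> {y, x} = {x} \<and> card {l\<in>T. z l < z y} = i \<and>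
           card {l\<in>T. z l < z x} = i + card ({x} \<inter> {y}) + (m - s - 1 - i) \<and>
           card T = i + (m - s - 1 - i) + s + card {x}}"
        unfolding R lows mem by blast
      have count: "card ?R = ((r + i) choose i) * ((m + n - 1 - s - k - (r + i) - 1) choose (m - s - 1 - i)) * ((s + k) choose s)"
        using card_subsets_two_cuts[OF fin inj y(1) x(1) yx, of "{x}" i "m - s - 1 - i" s]
        unfolding blocks x(2) x' y(2) by simp
      moreover have "(r + i) choose i = (r + i) choose r" by (rule choose_add_sym[symmetric])
      moreover have "(m + n - 1 - s - k - (r + i) - 1) choose (m - s - 1 - i) = (m + n - s - r - i - k - 2) choose (n - r - k - 1)"
      proof -
        have "s + 1 + i \<le> m" "r + k + 1 \<le> n" using low sr by auto
        then obtain p q where m: "m = s + 1 + i + p" and n: "n = r + k + 1 + q"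
          by (auto dest!: le_Suc_ex)
        show ?thesis using choose_add_sym[of p q] by (simp add: m n)
      qed
      ultimately show ?thesis using low by (simp only: if_True mult_ac simp_thms)
    next
      case notlow: False
      then have high: ?high using True by blast
      \<comment> \<open>The blocks have \<open>m + n - s - k - 1\<close>, \<open>k + i + s + r - (m + n)\<close> and
         \<open>m + n - r - i - 1\<close> elements.\<close>
      have "\<not> z y \<le> z x"
      proof
        assume "z y \<le> z x"
        then have "card {l\<in>I. z l < z y} \<le> card {l\<in>I. z l < z x}" using fin by (intro card_mono) auto
        then show False using x(2) y(2) high sr by linarith
      qed
      then have xy: "z x < z y" by simp
      then have "y \<noteq> x" by blast
      then have highs: "m - s - 1 + card ({x} \<inter> {x}) + (i + s - m) = i"
        "m - s - 1 + (i + s - m) + (m - i) + card {x} = m"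
        and mem: "T \<inter> {x, y} = {x} \<longleftrightarrow> x \<in> T \<and> y \<notin> T" for T
        using high sr by auto
      have blocks: "?R = {T. T \<subseteq> I \<and> T \<inter> {x, y} = {x} \<and> card {l\<in>T. z l < z x} = m - s - 1 \<and>
           card {l\<in>T. z l < z y} = m - s - 1 + card ({x} \<inter> {x}) + (i + s - m) \<and>
           card T = m - s - 1 + (i + s - m) + (m - i) + card {x}}"
        unfolding R highs mem by blast
      have count: "card ?R = ((m + n - 1 - s - k) choose (m - s - 1)) * ((r + i - (m + n - 1 - s - k) - 1) choose (i + s - m)) * ((m + n - 1 - r - i) choose (m - i))"
        using card_subsets_two_cuts[OF fin inj x(1) y(1) xy, of "{x}" "m - s - 1" "i + s - m" "m - i"]
        unfolding blocks x(2) y' y(2) by simp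
      moreover have "(r + i - (m + n - 1 - s - k) - 1) choose (i + s - m) = (k + i + s + r - (m + n)) choose (k + r - n)"
      proof -
        define p where "p = i + s - m"
        define q where "q = k + r - n"
        have pq: "i + s = m + p" "k + r = n + q"
          unfolding p_def q_def using high by auto
        then have "r + i - (m + n - 1 - s - k) - 1 = p + q" "k + i + s + r - (m + n) = p + q"
          using high sr by auto
        then show ?thesis unfolding p_def[symmetric] q_def[symmetric] by (simp only: choose_add_sym[of p q])
      qed
      moreover have "(m + n - 1 - r - i) choose (m - i) = (m + n - r - i - 1) choose (n - r - 1)"
      proof -
        obtain p q where m: "m = i + p" and n: "n = r + 1 + q"
          using high sr by (metis Suc_eq_plus1 Suc_leI le_Suc_ex)
        show ?thesis using choose_add_sym[of p q] by (simp add: m n)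
      qed
      moreover have "m + n - 1 - s - k = m + n - s - k - 1" by simp
      ultimately show ?thesis using high notlow by (simp only: if_True if_False mult_ac simp_thms)
    qed
  qed
qed

section \<open>Order statistics\<close>

text \<open>
  In a strictly increasing list the number of smaller entries is the position.
\<close>

lemma order_stat_eq_of_rank:
  assumes inj: "inj_on (\<lambda>l. X l \<omega>) {1..m}" and x: "x \<in> {1..m}"
    and rank: "card {l\<in>{1..m}. X l \<omega> < X x \<omega>} = j" and j: "j < m"
  shows "order_stat m X (j + 1) \<omega> = X x \<omega>"
proof -
  let ?f = "\<lambda>l. X l \<omega>"
  define L where "L = sort (map ?f [1..<Suc m])"
  have set: "set L = ?f ` {1..m}" unfolding L_def by (simp add: atLeastLessThanSuc_atLeastAtMost del: upt_Suc)
  have len: "length L = m" unfolding L_def by simp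
  have dist: "distinct L"
    unfolding L_def using inj by (simp add: distinct_map atLeastLessThanSuc_atLeastAtMost del: upt_Suc)
  have sorted: "sorted_wrt (<) L"
    using dist unfolding L_def by (metis sorted_sort strict_sorted_iff)
  obtain t where t: "t < m" "L ! t = ?f x"
    using x set len by (metis image_eqI in_set_conv_nth)
  have less: "L ! a < L ! b \<longleftrightarrow> a < b" if "a < m" "b < m" for a b
    using sorted_wrt_nth_less[OF sorted] that len by (metis linorder_neqE_nat order_less_asym less_irrefl)
  have "card {l\<in>{1..m}. ?f l < ?f x} = card (?f ` {l\<in>{1..m}. ?f l < ?f x})"
    using inj by (intro card_image[symmetric] inj_on_subset[OF inj]) auto
  also have "?f ` {l\<in>{1..m}. ?f l < ?f x} = {u \<in> set L. u < L ! t}"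
    unfolding set t(2) by auto
  also have "\<dots> = (\<lambda>a. L ! a) ` {..<t}"
  proof -
    have "set L = (\<lambda>a. L ! a) ` {..<m}" using len by (auto simp: set_conv_nth)
    then show ?thesis using less t(1) by auto
  qed
  also have "card \<dots> = t"
    using dist t(1) len by (subst card_image) (auto intro!: inj_on_nth)
  finally have "t = j" using rank by simp
  then show ?thesis using t(2) unfolding order_stat_def L_def by simp
qed

lemma nth_le_iff_length_filter:
  fixes xs :: "'b::linorder list"
  assumes "sorted xs" "j < length xs"
  shows "xs ! j \<le> c \<longleftrightarrow> j < length (filter (\<lambda>u. u \<le> c) xs)"
  using assms
proof (induction xs arbitrary: j)
  case (Cons x xs)
  show ?case
  proof (cases "x \<le> c")
    case True
    then show ?thesis using Cons by (cases j) auto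
  next
    case False
    then have "\<not> u \<le> c" if "u \<in> set (x # xs)" for u
      using Cons.prems(1) that by (auto dest: order_trans)
    then show ?thesis using nth_mem[OF Cons.prems(2)] filter_False[of "x # xs" "\<lambda>u. u \<le> c"] by (metis length_0_conv not_less0)
  qed
qed simp

text \<open>
  At every outcome, with or without ties, an order statistic is at most \<open>c\<close> iff enough observations
  are. This reduces the measurability of order statistics to that of finite counts.
\<close>

lemma order_stat_le_iff:
  assumes "j < m"
  shows "order_stat m X (j + 1) \<omega> \<le> c \<longleftrightarrow> j < card {l\<in>{1..m}. X l \<omega> \<le> c}"
proof -
  let ?xs = "map (\<lambda>l. X l \<omega>) [1..<Suc m]"
  have "length (filter (\<lambda>u. u \<le> c) (sort ?xs)) = length (filter (\<lambda>l. X l \<omega> \<le> c) [1..<Suc m])"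
    by (simp add: filter_sort filter_map comp_def del: upt_Suc)
  also have "\<dots> = card {l\<in>{1..m}. X l \<omega> \<le> c}"
    by (subst distinct_length_filter) (auto intro!: arg_cong[where f = card])
  finally show ?thesis
    using nth_le_iff_length_filter[of "sort ?xs" j c] assms unfolding order_stat_def by simp
qed

section \<open>Measurability\<close>

lemma measurable_card_Collect:
  fixes A :: "nat set"
  assumes "\<And>l. l \<in> A \<Longrightarrow> {\<omega>\<in>space M. P l \<omega>} \<in> sets M"
  shows "(\<lambda>\<omega>. card {l\<in>A. P l \<omega>}) \<in> measurable M (count_space UNIV)"
proof (rule measurable_card)
  show "{\<omega>\<in>space M. l \<in> {l\<in>A. P l \<omega>}} \<in> sets M" for l
    using assms[of l] by (cases "l \<in> A") auto
qed

lemma sets_Collect_eq_nat: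
  fixes f :: "'b \<Rightarrow> nat"
  assumes "f \<in> measurable M (count_space UNIV)"
  shows "{\<omega>\<in>space M. f \<omega> = c} \<in> sets M"
  using measurable_sets[OF assms, of "{c}"] by (simp add: vimage_def Int_def conj_commute)

lemma borel_measurable_order_stat:
  assumes X: "\<And>l. l \<in> {1..m} \<Longrightarrow> X l \<in> borel_measurable M" and j: "j < m"
  shows "order_stat m X (j + 1) \<in> borel_measurable M"
proof (rule borel_measurableI_le)
  fix c
  have "(\<lambda>\<omega>. card {l\<in>{1..m}. X l \<omega> \<le> c}) \<in> measurable M (count_space UNIV)"
    using X by (intro measurable_card_Collect borel_measurable_le) auto
  then have "(\<lambda>\<omega>. card {l\<in>{1..m}. X l \<omega> \<le> c}) -` {j<..} \<inter> space M \<in> sets M"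
    by (rule measurable_sets) simp
  also have "(\<lambda>\<omega>. card {l\<in>{1..m}. X l \<omega> \<le> c}) -` {j<..} \<inter> space M = {\<omega>\<in>space M. order_stat m X (j + 1) \<omega> \<le> c}"
    using order_stat_le_iff[OF j, of X _ c] by auto
  finally show "{\<omega>\<in>space M. order_stat m X (j + 1) \<omega> \<le> c} \<in> sets M" .
qed

lemma sets_exceedance_precedence:
  assumes X: "\<And>l. l \<in> {1..m} \<Longrightarrow> X l \<in> borel_measurable M" and Y: "\<And>l. l \<in> {1..n} \<Longrightarrow> Y l \<in> borel_measurable M"
    and "s < m" "r < n"
  shows "{\<omega>\<in>space M. exceedance m X n Y s \<omega> = k \<and> precedence m X n Y r \<omega> = i} \<in> sets M"
proof -
  have "order_stat m X (m - s) \<in> borel_measurable M"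
  proof -
    have "m - s - 1 + 1 = m - s" using \<open>s < m\<close> by simp
    then show ?thesis using borel_measurable_order_stat[of m X M "m - s - 1"] X \<open>s < m\<close> by simp
  qed
  then have "exceedance m X n Y s \<in> measurable M (count_space UNIV)"
    unfolding exceedance_def using Y by (intro measurable_card_Collect borel_measurable_less) auto
  moreover have "order_stat n Y (1 + r) \<in> borel_measurable M"
    using borel_measurable_order_stat[of n Y M r] Y \<open>r < n\<close> by simp
  then have "precedence m X n Y r \<in> measurable M (count_space UNIV)"
    unfolding precedence_def using X by (intro measurable_card_Collect borel_measurable_less) auto
  ultimately have "{\<omega>\<in>space M. exceedance m X n Y s \<omega> = k} \<inter> {\<omega>\<in>space M. precedence m X n Y r \<omega> = i} \<in> sets M"
    by (intro sets.Int sets_Collect_eq_nat)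
  then show ?thesis by (simp add: Int_def conj_ac cong: conj_cong)
qed

lemma measurable_rank_event:
  fixes I :: "nat set" and N :: "(nat \<Rightarrow> real) measure"
  assumes N: "sets N = sets (PiM I (\<lambda>_. borel))" and AB: "A \<subseteq> I" "B \<subseteq> I" and I: "finite I"
  shows "{z \<in> space N. rank_event z A B p r k i} \<in> sets N"
proof -
  have comp: "(\<lambda>z. z l) \<in> borel_measurable N" if "l \<in> I" for l
    using that measurable_component_singleton[OF that, of "\<lambda>_. borel :: real measure"]
    by (simp cong: measurable_cong_sets add: measurable_cong_sets[OF N refl])
  have less: "(\<lambda>z. card {l\<in>C. z l < z x}) \<in> measurable N (count_space UNIV)"
    and greater: "(\<lambda>z. card {l\<in>C. z x < z l}) \<in> measurable N (count_space UNIV)"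
    if "C \<subseteq> I" "x \<in> I" for C x
    using comp that by (intro measurable_card_Collect borel_measurable_less; auto)+
  have fin: "finite A" "finite B" using AB I finite_subset by blast+
  have "{z \<in> space N. rank_event z A B p r k i} = (\<Union>x\<in>A. \<Union>y\<in>B.
      {z \<in> space N. card {l\<in>A. z l < z x} = p} \<inter> {z \<in> space N. card {l\<in>B. z l < z y} = r} \<inter>
      ({z \<in> space N. card {l\<in>B. z x < z l} = k} \<inter> {z \<in> space N. card {l\<in>A. z l < z y} = i}))"
    unfolding rank_event_def by auto
  also have "\<dots> \<in> sets N"
    using AB fin by (intro sets.finite_UN sets.Int sets_Collect_eq_nat less greater) auto
  finally show ?thesis .
qed

section \<open>Absence of ties\<close>

text \<open>
  The density defines a finite Borel measure with distribution function \<open>F\<close>. It vanishes on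
  points, as Lebesgue measure does, and for distribution functions this is continuity.
\<close>

lemma isCont_abs_continuous_df:
  assumes "abs_continuous_df F"
  shows "isCont F x"
proof -
  obtain f where f: "\<And>t. f t \<ge> 0" "integrable lborel f" "\<And>x. F x = (LBINT t:{..x}. f t)"
    using assms unfolding abs_continuous_df_def by blast
  define D where "D = density lborel (\<lambda>t. ennreal (f t))"
  have D: "emeasure D A = ennreal (LBINT t:A. f t)" if "A \<in> sets borel" for A
  proof -
    have "emeasure D A = (\<integral>\<^sup>+t. ennreal (f t) * indicator A t \<partial>lborel)"
      unfolding D_def using f(2) that by (intro emeasure_density) auto
    also have "\<dots> = (\<integral>\<^sup>+t. ennreal (indicator A t * f t) \<partial>lborel)"
      by (intro nn_integral_cong) (simp split: split_indicator)
    also have "\<dots> = ennreal (LBINT t:A. f t)"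
    proof -
      have "integrable lborel (\<lambda>t. indicator A t * f t)"
        using integrable_mult_indicator[OF _ f(2), of A] that by simp
      then show ?thesis
        unfolding set_lebesgue_integral_def real_scaleR_def
        using f(1) by (intro nn_integral_eq_integral AE_I2) simp_all
    qed
    finally show ?thesis .
  qed
  have sets_D: "sets D = sets borel" and space_D: "space D = UNIV" by (simp_all add: D_def)
  interpret D: finite_borel_measure D
  proof (intro finite_borel_measure.intro finite_borel_measure_axioms.intro finite_measureI)
    show "emeasure D (space D) \<noteq> \<infinity>" using D[of UNIV] space_D by simp
    show "sets D = sets borel" by fact
  qed
  have "cdf D = F"
  proof
    fix y
    have "(LBINT t:{..y}. f t) \<ge> 0"
      unfolding set_lebesgue_integral_def using f(1) by (intro integral_nonneg_AE AE_I2) (simp split: split_indicator)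
    then show "cdf D y = F y" unfolding cdf_def measure_def f(3) by (simp add: D)
  qed
  moreover have "emeasure D {x} = 0"
  proof -
    have "{x} \<in> null_sets lborel" by (simp add: null_sets_def)
    then have "AE t in lborel. t \<notin> {x}" by (rule AE_not_in)
    then have "AE t in lborel. t \<in> {x} \<longrightarrow> ennreal (f t) = 0" by (rule eventually_mono) blast
    then have "{x} \<in> null_sets D"
      unfolding D_def using f(2) by (subst null_sets_density_iff) auto
    then show ?thesis by auto
  qed
  then have "measure D {x} = 0" by (simp add: measure_def)
  ultimately show ?thesis using D.isCont_cdf by metis
qed

text \<open>
  For \<open>i \<noteq> j\<close> the joint law of two coordinates is \<open>\<mu> \<Otimes>\<^sub>M \<mu>\<close>, and by Fubini the diagonal has the
  measure \<open>\<integral> \<mu> {x} \<partial>\<mu> = 0\<close>.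
\<close>

lemma AE_PiM_inj_on:
  fixes \<mu> :: "real measure"
  assumes "prob_space \<mu>" and sets_mu: "sets \<mu> = sets borel" and atomless: "\<And>x. emeasure \<mu> {x} = 0"
    and I: "finite I"
  shows "AE z in PiM I (\<lambda>_. \<mu>). inj_on z I"
proof -
  interpret mu: prob_space \<mu> by fact
  interpret P: product_prob_space "\<lambda>_. \<mu>" I ..
  interpret pair_sigma_finite \<mu> \<mu> ..
  let ?N = "PiM I (\<lambda>_. \<mu>)"
  have "AE z in ?N. z i \<noteq> z j" if ij: "i \<in> I" "j \<in> I" "i \<noteq> j" for i j
  proof -
    have [measurable]: "(\<lambda>z. (z i, z j)) \<in> measurable ?N (\<mu> \<Otimes>\<^sub>M \<mu>)" using ij by simp
    have pair: "\<mu> \<Otimes>\<^sub>M \<mu> = distr ?N (\<mu> \<Otimes>\<^sub>M \<mu>) (\<lambda>z. (z i, z j))"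
    proof (rule pair_measure_eqI)
      fix A B assume AB: "A \<in> sets \<mu>" "B \<in> sets \<mu>"
      define C where "C = (\<lambda>l. if l = i then A else B)"
      have "emeasure (distr ?N (\<mu> \<Otimes>\<^sub>M \<mu>) (\<lambda>z. (z i, z j))) (A \<times> B)
          = emeasure ?N ((\<lambda>z. (z i, z j)) -` (A \<times> B) \<inter> space ?N)"
        using AB by (intro emeasure_distr) auto
      also have "(\<lambda>z. (z i, z j)) -` (A \<times> B) \<inter> space ?N = prod_emb I (\<lambda>_. \<mu>) {i, j} (Pi\<^sub>E {i, j} C)"
        using ij by (auto simp: prod_emb_def space_PiM C_def PiE_iff)
      also have "emeasure ?N \<dots> = (\<Prod>l\<in>{i, j}. emeasure \<mu> (C l))"
        using ij AB by (intro P.emeasure_PiM_emb) (auto simp: C_def)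
      also have "\<dots> = emeasure \<mu> A * emeasure \<mu> B"
        using ij by (simp add: C_def)
      finally show "emeasure \<mu> A * emeasure \<mu> B = emeasure (distr ?N (\<mu> \<Otimes>\<^sub>M \<mu>) (\<lambda>z. (z i, z j))) (A \<times> B)" ..
    qed (auto intro: mu.sigma_finite_measure_axioms)
    let ?diag = "{p :: real \<times> real. fst p = snd p}"
    have diag: "?diag \<in> sets (\<mu> \<Otimes>\<^sub>M \<mu>)"
    proof -
      have "closed ?diag" by (intro closed_Collect_eq continuous_intros)
      then have "?diag \<in> sets (borel \<Otimes>\<^sub>M borel)" unfolding borel_prod by (rule borel_closed)
      then show ?thesis using sets_pair_measure_cong[OF sets_mu sets_mu] by simp
    qed
    have "emeasure (\<mu> \<Otimes>\<^sub>M \<mu>) ?diag = (\<integral>\<^sup>+x. emeasure \<mu> (Pair x -` ?diag) \<partial>\<mu>)"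
      using diag by (rule mu.emeasure_pair_measure_alt)
    also have "\<dots> = (\<integral>\<^sup>+x. emeasure \<mu> {x} \<partial>\<mu>)"
      by (intro nn_integral_cong arg_cong[where f = "emeasure \<mu>"]) auto
    finally have "?diag \<in> null_sets (distr ?N (\<mu> \<Otimes>\<^sub>M \<mu>) (\<lambda>z. (z i, z j)))"
      using diag pair atomless by (simp add: null_sets_def)
    then have "AE p in distr ?N (\<mu> \<Otimes>\<^sub>M \<mu>) (\<lambda>z. (z i, z j)). p \<notin> ?diag" by (rule AE_not_in)
    then show ?thesis
      by (auto dest: AE_distrD[rotated])
  qed
  then have "AE z in ?N. \<forall>i\<in>I. \<forall>j\<in>I - {i}. z i \<noteq> z j"
    using I by (intro AE_finite_allI) auto
  then show ?thesis by (elim eventually_mono) (auto intro!: inj_onI)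
qed

section \<open>The pooled sample\<close>

definition pooled :: "nat \<Rightarrow> (nat \<Rightarrow> 'a \<Rightarrow> real) \<Rightarrow> (nat \<Rightarrow> 'a \<Rightarrow> real) \<Rightarrow> nat \<Rightarrow> 'a \<Rightarrow> real" where
  "pooled m X Y j \<omega> = (if j \<le> m then X j \<omega> else Y (j - m) \<omega>)"

text \<open>
  Both measures agree on boxes: independence of the two vectors separates the factors belonging to
  \<open>X\<close> and \<open>Y\<close>, independence within the samples splits these further.
\<close>

lemma distr_pooled:
  fixes \<mu> :: "real measure"
  assumes "prob_space M" and mn: "m \<ge> 1" "n \<ge> 1"
    and X: "prob_space.indep_vars M (\<lambda>_. borel) X {1..m}" "\<And>j. j \<in> {1..m} \<Longrightarrow> distr M borel (X j) = \<mu>"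
    and Y: "prob_space.indep_vars M (\<lambda>_. borel) Y {1..n}" "\<And>j. j \<in> {1..n} \<Longrightarrow> distr M borel (Y j) = \<mu>"
    and XY: "samples_indep M m X n Y"
  shows "distr M (PiM {1..m + n} (\<lambda>_. borel)) (\<lambda>\<omega>. \<lambda>j\<in>{1..m + n}. pooled m X Y j \<omega>) = PiM {1..m + n} (\<lambda>_. \<mu>)"
    and "(\<lambda>\<omega>. \<lambda>j\<in>{1..m + n}. pooled m X Y j \<omega>) \<in> measurable M (PiM {1..m + n} (\<lambda>_. borel))"
proof -
  interpret prob_space M by fact
  let ?Z = "\<lambda>\<omega>. \<lambda>j\<in>{1..m + n}. pooled m X Y j \<omega>"
  have rvX: "random_variable borel (X j)" if "j \<in> {1..m}" for j
    using X(1) that unfolding indep_vars_def by blast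
  have rvY: "random_variable borel (Y j)" if "j \<in> {1..n}" for j
    using Y(1) that unfolding indep_vars_def by blast
  have mu: "prob_space \<mu>" "sets \<mu> = sets borel"
    using X(2)[of 1] mn prob_space_distr[OF rvX[of 1]] sets_distr[of M borel "X 1"] by auto
  interpret mu: prob_space \<mu> by fact
  interpret P: product_sigma_finite "\<lambda>_. \<mu>" ..
  show meas: "?Z \<in> measurable M (PiM {1..m + n} (\<lambda>_. borel))"
  proof (rule measurable_restrict)
    fix j assume "j \<in> {1..m + n}"
    then have "j \<le> m \<and> j \<in> {1..m} \<or> \<not> j \<le> m \<and> j - m \<in> {1..n}" by auto
    then show "random_variable borel (pooled m X Y j)"
      using rvX[of j] rvY[of "j - m"] unfolding pooled_def by (elim disjE) simp_all
  qed
  show "distr M (PiM {1..m + n} (\<lambda>_. borel)) ?Z = PiM {1..m + n} (\<lambda>_. \<mu>)"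
  proof (rule P.PiM_eqI)
    show "sets (distr M (PiM {1..m + n} (\<lambda>_. borel)) ?Z) = sets (PiM {1..m + n} (\<lambda>_. \<mu>))"
      using mu(2) by (simp cong: sets_PiM_cong)
    fix A :: "nat \<Rightarrow> real set" assume A: "\<And>i. i \<in> {1..m + n} \<Longrightarrow> A i \<in> sets \<mu>"
    then have A': "A i \<in> sets borel" if "i \<in> {1..m + n}" for i using that mu(2) by blast
    have law: "prob (V -` B \<inter> space M) = measure \<mu> B"
      if "random_variable borel V" "distr M borel V = \<mu>" "B \<in> sets borel" for V :: "'a \<Rightarrow> real" and B
      using measure_distr[OF that(1), of B] that(2,3) by simp
    let ?EX = "(\<lambda>\<omega>. \<lambda>j\<in>{1..m}. X j \<omega>) -` (Pi\<^sub>E {1..m} A) \<inter> space M"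
    let ?EY = "(\<lambda>\<omega>. \<lambda>j\<in>{1..n}. Y j \<omega>) -` (Pi\<^sub>E {1..n} (\<lambda>j. A (j + m))) \<inter> space M"
    have "prob ?EX = prob (\<Inter>j\<in>{1..m}. X j -` A j \<inter> space M)"
      using mn by (intro arg_cong[where f = prob]) (auto simp: PiE_iff)
    also have "\<dots> = (\<Prod>j\<in>{1..m}. prob (X j -` A j \<inter> space M))"
      using mn A' by (intro indep_varsD_finite[OF X(1)]) auto
    also have "\<dots> = (\<Prod>j\<in>{1..m}. measure \<mu> (A j))"
      by (intro prod.cong refl law rvX X(2) A') auto
    finally have EX: "prob ?EX = (\<Prod>j\<in>{1..m}. measure \<mu> (A j))" .
    have "prob ?EY = prob (\<Inter>j\<in>{1..n}. Y j -` A (j + m) \<inter> space M)"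
      using mn by (intro arg_cong[where f = prob]) (auto simp: PiE_iff)
    also have "\<dots> = (\<Prod>j\<in>{1..n}. prob (Y j -` A (j + m) \<inter> space M))"
      using mn A' by (intro indep_varsD_finite[OF Y(1)]) auto
    also have "\<dots> = (\<Prod>j\<in>{1..n}. measure \<mu> (A (j + m)))"
      by (intro prod.cong refl law rvY Y(2) A') auto
    finally have EY: "prob ?EY = (\<Prod>j\<in>{1..n}. measure \<mu> (A (j + m)))" .
    have box: "Pi\<^sub>E {1..m + n} A \<in> sets (PiM {1..m + n} (\<lambda>_. borel))"
      using A' by (intro sets_PiM_I_finite) auto
    have "?Z -` (Pi\<^sub>E {1..m + n} A) \<inter> space M =
        (\<lambda>\<omega>. (\<lambda>j\<in>{1..m}. X j \<omega>, \<lambda>j\<in>{1..n}. Y j \<omega>)) -` (Pi\<^sub>E {1..m} A \<times> Pi\<^sub>E {1..n} (\<lambda>j. A (j + m))) \<inter> space M"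
    proof -
      have "(\<forall>j\<in>{1..m + n}. pooled m X Y j \<omega> \<in> A j) \<longleftrightarrow>
          (\<forall>j\<in>{1..m}. X j \<omega> \<in> A j) \<and> (\<forall>j\<in>{1..n}. Y j \<omega> \<in> A (j + m))" (is "?l \<longleftrightarrow> ?r") for \<omega>
      proof
        assume l: ?l
        show ?r
        proof (intro conjI ballI)
          fix j assume "j \<in> {1..m}" then show "X j \<omega> \<in> A j" using bspec[OF l, of j] by (simp add: pooled_def)
        next
          fix j assume "j \<in> {1..n}" then show "Y j \<omega> \<in> A (j + m)" using bspec[OF l, of "j + m"] by (simp add: pooled_def)
        qed
      next
        assume r: ?r
        show ?l
        proof
          fix j assume j: "j \<in> {1..m + n}"
          have "j \<le> m \<or> j - m \<in> {1..n}" using j by auto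
          then show "pooled m X Y j \<omega> \<in> A j"
            using bspec[OF conjunct1[OF r], of j] bspec[OF conjunct2[OF r], of "j - m"] j
            by (cases "j \<le> m") (auto simp: pooled_def)
        qed
      qed
      then show ?thesis by (auto simp: PiE_iff)
    qed
    then have "measure (distr M (PiM {1..m + n} (\<lambda>_. borel)) ?Z) (Pi\<^sub>E {1..m + n} A) = prob ?EX * prob ?EY"
      using indep_varD[OF XY[unfolded samples_indep_def], of "Pi\<^sub>E {1..m} A" "Pi\<^sub>E {1..n} (\<lambda>j. A (j + m))"] A'
        measure_distr[OF meas box]
      by (simp add: sets_PiM_I_finite)
    also have "\<dots> = (\<Prod>j\<in>{1..m}. measure \<mu> (A j)) * (\<Prod>j\<in>{1 + m..n + m}. measure \<mu> (A j))"
      unfolding EX EY prod.shift_bounds_cl_nat_ivl ..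
    also have "\<dots> = (\<Prod>j\<in>{1..m + n}. measure \<mu> (A j))"
      using prod.ub_add_nat[of 1 m "\<lambda>j. measure \<mu> (A j)" n] by (simp add: add.commute)
    finally show "emeasure (distr M (PiM {1..m + n} (\<lambda>_. borel)) ?Z) (Pi\<^sub>E {1..m + n} A) = (\<Prod>j\<in>{1..m + n}. emeasure \<mu> (A j))"
      using finite_measure.emeasure_eq_measure[OF prob_space.finite_measure[OF prob_space_distr[OF meas]]]
      by (simp add: mu.emeasure_eq_measure prod_ennreal)
  qed simp
qed

text \<open>
  Without ties, the elements \<open>x\<close> and \<open>y\<close> in \<^const>\<open>rank_event\<close> exist, are unique, and carry the
  order statistics.
\<close>

lemma rank_event_pooled_iff:
  assumes mn: "s < m" "r < n"
    and inj: "inj_on (\<lambda>j\<in>{1..m + n}. pooled m X Y j \<omega>) {1..m + n}"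
  shows "rank_event (\<lambda>j\<in>{1..m + n}. pooled m X Y j \<omega>) {1..m} {m + 1..m + n} (m - s - 1) r k i \<longleftrightarrow>
     exceedance m X n Y s \<omega> = k \<and> precedence m X n Y r \<omega> = i"
proof -
  define z where "z = (\<lambda>j\<in>{1..m + n}. pooled m X Y j \<omega>)"
  note inj = inj[folded z_def]
  let ?x = "\<lambda>l. X l \<omega>" and ?y = "\<lambda>l. Y l \<omega>"
  have zx: "z l = X l \<omega>" if "l \<in> {1..m}" for l using that by (simp add: z_def pooled_def)
  have zy: "z (l + m) = Y l \<omega>" if "l \<in> {1..n}" for l using that by (simp add: z_def pooled_def)
  have B: "{m + 1..m + n} = (\<lambda>l. l + m) ` {1..n}" by (simp only: image_add_atLeastAtMost' add.commute[of m])
  have injx: "inj_on ?x {1..m}"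
  proof (rule inj_onI)
    fix a b assume ab: "a \<in> {1..m}" "b \<in> {1..m}" "X a \<omega> = X b \<omega>"
    then have "z a = z b" by (simp only: zx)
    then show "a = b" by (rule inj_onD[OF inj]) (use ab in auto)
  qed
  have injy: "inj_on ?y {1..n}"
  proof (rule inj_onI)
    fix a b assume ab: "a \<in> {1..n}" "b \<in> {1..n}" "Y a \<omega> = Y b \<omega>"
    then have "z (a + m) = z (b + m)" by (simp only: zy)
    then have "a + m = b + m" by (rule inj_onD[OF inj]) (use ab in auto)
    then show "a = b" by simp
  qed
  obtain x where x: "x \<in> {1..m}" "card {l\<in>{1..m}. X l \<omega> < X x \<omega>} = m - s - 1"
    using ex_rank[OF _ injx, of "m - s - 1"] mn by auto
  obtain y where y: "y \<in> {1..n}" "card {l\<in>{1..n}. Y l \<omega> < Y y \<omega>} = r"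
    using ex_rank[OF _ injy, of r] mn by auto
  have X: "order_stat m X (m - s) \<omega> = X x \<omega>"
  proof -
    have "m - s = m - s - 1 + 1" using mn by simp
    then show ?thesis
      using order_stat_eq_of_rank[of X \<omega> m x "m - s - 1", OF injx x] mn by (simp only:)
  qed
  have Y: "order_stat n Y (1 + r) \<omega> = Y y \<omega>"
    using order_stat_eq_of_rank[of Y \<omega> n y r, OF injy y] mn by simp
  have card_x: "card {l\<in>{1..m}. P (z l)} = card {l\<in>{1..m}. P (X l \<omega>)}" for P
    by (intro arg_cong[where f = card] Collect_cong conj_cong refl) (simp only: zx)
  have card_y: "card {l\<in>{m + 1..m + n}. P (z l)} = card {l\<in>{1..n}. P (Y l \<omega>)}" for P
  proof -
    have "{l\<in>{m + 1..m + n}. P (z l)} = (\<lambda>l. l + m) ` {l\<in>{1..n}. P (Y l \<omega>)}"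
    proof (intro equalityI subsetI)
      fix l assume l: "l \<in> {l\<in>{m + 1..m + n}. P (z l)}"
      then obtain l' where l': "l' \<in> {1..n}" "l = l' + m" unfolding B by blast
      then have "P (Y l' \<omega>)" using l zy[OF l'(1)] by simp
      then show "l \<in> (\<lambda>l. l + m) ` {l\<in>{1..n}. P (Y l \<omega>)}" using l' by blast
    next
      fix l assume "l \<in> (\<lambda>l. l + m) ` {l\<in>{1..n}. P (Y l \<omega>)}"
      then obtain l' where l': "l' \<in> {1..n}" "l = l' + m" "P (Y l' \<omega>)" by blast
      then show "l \<in> {l\<in>{m + 1..m + n}. P (z l)}" using zy[OF l'(1)] by auto
    qed
    then show ?thesis by (simp add: card_image)
  qed
  have less: "card {l\<in>{1..m}. z l < c} = card {l\<in>{1..m}. X l \<omega> < c}"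
    "card {l\<in>{m + 1..m + n}. z l < c} = card {l\<in>{1..n}. Y l \<omega> < c}" for c
    by (rule card_x card_y)+
  have greater: "card {l\<in>{m + 1..m + n}. c < z l} = card {l\<in>{1..n}. c < Y l \<omega>}" for c
    by (rule card_y)
  have ux: "x' = x" if "x' \<in> {1..m}" "card {l\<in>{1..m}. X l \<omega> < X x' \<omega>} = m - s - 1" for x'
    using inj_onD[OF inj_on_rank[OF _ injx], of x' x] that x by simp
  have uy: "y' = y" if "y' \<in> {1..n}" "card {l\<in>{1..n}. Y l \<omega> < Y y' \<omega>} = r" for y'
    using inj_onD[OF inj_on_rank[OF _ injy], of y' y] that y by simp
  have "rank_event z {1..m} {m + 1..m + n} (m - s - 1) r k i \<longleftrightarrow>
     (\<exists>x'\<in>{1..m}. \<exists>y'\<in>{1..n}. card {l\<in>{1..m}. X l \<omega> < z x'} = m - s - 1 \<and>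
        card {l\<in>{1..n}. Y l \<omega> < z (y' + m)} = r \<and>
        card {l\<in>{1..n}. z x' < Y l \<omega>} = k \<and> card {l\<in>{1..m}. X l \<omega> < z (y' + m)} = i)"
    unfolding rank_event_def less greater unfolding B Set.bex_simps(7) ..
  also have "\<dots> \<longleftrightarrow> (\<exists>x'\<in>{1..m}. \<exists>y'\<in>{1..n}. card {l\<in>{1..m}. X l \<omega> < X x' \<omega>} = m - s - 1 \<and>
        card {l\<in>{1..n}. Y l \<omega> < Y y' \<omega>} = r \<and>
        card {l\<in>{1..n}. X x' \<omega> < Y l \<omega>} = k \<and> card {l\<in>{1..m}. X l \<omega> < Y y' \<omega>} = i)"
    by (intro bex_cong refl) (simp only: zx zy)
  also have "\<dots> \<longleftrightarrow> card {l\<in>{1..n}. X x \<omega> < Y l \<omega>} = k \<and> card {l\<in>{1..m}. X l \<omega> < Y y \<omega>} = i"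
    (is "?L \<longleftrightarrow> ?R")
  proof
    assume ?L
    then obtain x' y' where x': "x' \<in> {1..m}" "card {l\<in>{1..m}. X l \<omega> < X x' \<omega>} = m - s - 1"
      and y': "y' \<in> {1..n}" "card {l\<in>{1..n}. Y l \<omega> < Y y' \<omega>} = r"
      and *: "card {l\<in>{1..n}. X x' \<omega> < Y l \<omega>} = k" "card {l\<in>{1..m}. X l \<omega> < Y y' \<omega>} = i"
      by blast
    show ?R using * unfolding ux[OF x'] uy[OF y'] by blast
  next
    assume ?R
    then show ?L using x y by blast
  qed
  also have "\<dots> \<longleftrightarrow> exceedance m X n Y s \<omega> = k \<and> precedence m X n Y r \<omega> = i"
    unfolding exceedance_def precedence_def X Y ..
  finally show ?thesis unfolding z_def .
qed

section \<open>Averaging over exchangeable positions\<close>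

text \<open>
  Exchangeability: a permutation of the coordinates that carries the first \<open>m\<close> indices onto \<open>T\<close>
  preserves the product measure.
\<close>

lemma prob_rank_event_exchange:
  fixes \<mu> :: "real measure"
  assumes "prob_space \<mu>" and sets_mu: "sets \<mu> = sets borel"
    and T: "T \<subseteq> {1..m + n}" "card T = m"
  defines "N \<equiv> PiM {1..m + n} (\<lambda>_. \<mu>)"
  shows "measure N {z \<in> space N. rank_event z T ({1..m + n} - T) p r k i}
       = measure N {z \<in> space N. rank_event z {1..m} {m + 1..m + n} p r k i}"
proof -
  let ?I = "{1..m + n}"
  have finT: "finite T" using T finite_subset by blast
  obtain f where f: "bij_betw f {1..m} T"
    using T finT by (metis card_atLeastAtMost diff_Suc_1 finite_atLeastAtMost finite_same_card_bij)
  have "card (?I - T) = n" using T finT by (simp add: card_Diff_subset)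
  then obtain g where g: "bij_betw g {m + 1..m + n} (?I - T)"
    using finite_same_card_bij[of "{m + 1..m + n}" "?I - T"] by auto
  \<comment> \<open>A permutation of the pooled indices that carries the first block onto \<open>T\<close>.\<close>
  define \<pi> where "\<pi> = (\<lambda>l. if l \<in> {1..m} then f l else g l)"
  have f': "bij_betw \<pi> {1..m} T"
    using f by (subst bij_betw_cong[of _ _ f]) (auto simp: \<pi>_def)
  have g': "bij_betw \<pi> {m + 1..m + n} (?I - T)"
    using g by (subst bij_betw_cong[of _ _ g]) (auto simp: \<pi>_def)
  have I: "{1..m} \<union> {m + 1..m + n} = ?I" by auto
  have pi: "bij_betw \<pi> ?I ?I"
    using bij_betw_combine[OF f' g'] T(1) I by (simp add: Un_absorb1)
  have N: "sets N = sets (PiM ?I (\<lambda>_. borel))"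
    unfolding N_def using sets_mu by (intro sets_PiM_cong) auto
  have N_reindex: "distr N N (\<lambda>z. \<lambda>l\<in>?I. z (\<pi> l)) = N"
    unfolding N_def using pi assms(1) by (intro distr_PiM_reindex) (auto simp: bij_betw_def)
  have meas: "(\<lambda>z. \<lambda>l\<in>?I. z (\<pi> l)) \<in> measurable N N"
    unfolding N_def using pi by (intro measurable_restrict measurable_component_singleton) (auto simp: bij_betw_def)
  let ?E = "{z \<in> space N. rank_event z {1..m} {m + 1..m + n} p r k i}"
  have "measure N ?E = measure (distr N N (\<lambda>z. \<lambda>l\<in>?I. z (\<pi> l))) ?E" using N_reindex by simp
  also have "\<dots> = measure N ((\<lambda>z. \<lambda>l\<in>?I. z (\<pi> l)) -` ?E \<inter> space N)"
    by (intro measure_distr meas measurable_rank_event[OF N]) auto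
  also have "(\<lambda>z. \<lambda>l\<in>?I. z (\<pi> l)) -` ?E \<inter> space N
      = {z \<in> space N. rank_event (\<lambda>l\<in>?I. z (\<pi> l)) {1..m} {m + 1..m + n} p r k i}"
    using measurable_space[OF meas] by auto
  also have "\<dots> = {z \<in> space N. rank_event z T (?I - T) p r k i}"
  proof -
    have "rank_event (\<lambda>l\<in>?I. z (\<pi> l)) {1..m} {m + 1..m + n} p r k i \<longleftrightarrow>
        rank_event z (\<pi> ` {1..m}) (\<pi> ` {m + 1..m + n}) p r k i" for z :: "nat \<Rightarrow> real"
      using pi unfolding I[symmetric] by (intro rank_event_reindex) (auto simp: bij_betw_def)
    then show ?thesis using f' g' by (simp add: bij_betw_def)
  qed
  finally show ?thesis ..
qed

text \<open>
  By exchangeability the probability is unchanged when the first sample is placed on any other index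
  set \<open>T\<close> of size \<open>m\<close>. Summing over all \<open>T\<close> therefore gives the number of index sets times the
  probability; on the other hand the sum is the expected number of \<open>T\<close> for which the event holds,
  and this number almost surely is the constant \<open>c\<close>.
\<close>

lemma prob_rank_event_eq_count:
  fixes \<mu> :: "real measure"
  assumes mu: "prob_space \<mu>" and sets_mu: "sets \<mu> = sets borel" and atomless: "\<And>x. emeasure \<mu> {x} = 0"
    and count: "\<And>z :: nat \<Rightarrow> real. inj_on z {1..m + n} \<Longrightarrow>
      card {T. T \<subseteq> {1..m + n} \<and> card T = m \<and> rank_event z T ({1..m + n} - T) p r k i} = c"
  defines "N \<equiv> PiM {1..m + n} (\<lambda>_. \<mu>)"
  shows "measure N {z \<in> space N. rank_event z {1..m} {m + 1..m + n} p r k i} = real c / real ((m + n) choose n)"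
proof -
  let ?I = "{1..m + n}"
  interpret N: prob_space N unfolding N_def using mu by (intro prob_space_PiM)
  define S where "S = {T. T \<subseteq> ?I \<and> card T = m}"
  define E where "E = (\<lambda>T. {z \<in> space N. rank_event z T (?I - T) p r k i})"
  let ?P = "N.prob {z \<in> space N. rank_event z {1..m} {m + 1..m + n} p r k i}"
  have S: "finite S" "card S = (m + n) choose n"
    unfolding S_def using n_subsets[of ?I m] binomial_symmetric[of m "m + n"] by auto
  have N: "sets N = sets (PiM ?I (\<lambda>_. borel))"
    unfolding N_def using sets_mu by (intro sets_PiM_cong) auto
  have E: "E T \<in> sets N" if "T \<in> S" for T
    unfolding E_def using that by (intro measurable_rank_event[OF N]) (auto simp: S_def)
  have "real (card S) * ?P = (\<Sum>T\<in>S. N.prob (E T))"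
    using prob_rank_event_exchange[OF mu sets_mu] by (simp add: S_def E_def N_def)
  also have "\<dots> = (\<Sum>T\<in>S. N.expectation (indicator (E T)))"
    using E by (intro sum.cong refl) (simp add: sets.Int_space_eq2)
  also have "\<dots> = N.expectation (\<lambda>z. \<Sum>T\<in>S. indicator (E T) z)"
    using E by (subst Bochner_Integration.integral_sum) (auto simp: N.emeasure_eq_measure)
  also have "\<dots> = N.expectation (\<lambda>z. real c)"
  proof (rule integral_cong_AE)
    have "AE z in N. inj_on z ?I"
      unfolding N_def by (rule AE_PiM_inj_on[OF mu sets_mu atomless]) simp
    then show "AE z in N. (\<Sum>T\<in>S. indicator (E T) z) = real c"
      using AE_space
    proof eventually_elim
      case (elim z)
      have "(\<Sum>T\<in>S. indicator (E T) z :: real) = real (card {T\<in>S. z \<in> E T})"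
        using S(1) by (simp add: indicator_def sum.If_cases Int_def)
      also have "{T\<in>S. z \<in> E T} = {T. T \<subseteq> ?I \<and> card T = m \<and> rank_event z T (?I - T) p r k i}"
        using elim(2) by (auto simp: S_def E_def)
      finally show ?case using count[OF elim(1)] by simp
    qed
  qed (use E in auto)
  also have "\<dots> = real c" by (simp add: N.prob_space)
  finally have *: "real ((m + n) choose n) * ?P = real c" using S(2) by simp
  have "real ((m + n) choose n) \<noteq> 0" by simp
  then show ?thesis using * by (simp add: field_simps)
qed

section \<open>The joint mass function\<close>

theorem theorem3p1:
  fixes M :: "'a measure"
    and X Y :: "nat \<Rightarrow> 'a \<Rightarrow> real"
    and F G :: "real \<Rightarrow> real"
    and m n s r :: nat
  assumes "prob_space M"
    and "m \<ge> 1" and "n \<ge> 1"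
    and "random_sample M m X F" and "abs_continuous_df F"
    and "random_sample M n Y G" and "abs_continuous_df G"
    and "samples_indep M m X n Y"
    and "s < m" and "r < n"
    and H0: "\<forall>x. F x = G x"
  shows "\<forall>k i :: nat.
    measure M {\<omega> \<in> space M. exceedance m X n Y s \<omega> = k \<and> precedence m X n Y r \<omega> = i} =
      (if 0 \<le> i \<and> i \<le> m - s - 1 \<and> 0 \<le> k \<and> k \<le> n - r - 1 then
         real ((s + k) choose s) * real ((r + i) choose r) / real ((m + n) choose n)
           * real ((m + n - s - r - i - k - 2) choose (n - r - k - 1))
       else if m - s \<le> i \<and> i \<le> m \<and> n - r \<le> k \<and> k \<le> n then
         real ((m + n - r - i - 1) choose (n - r - 1))
           * real ((m + n - s - k - 1) choose (m - s - 1)) / real ((m + n) choose n)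
           * real ((k + i + s + r - (m + n)) choose (k + r - n))
       else 0)"
proof (intro allI)
  fix k i :: nat
  interpret prob_space M by fact
  let ?I = "{1..m + n}"
  let ?Z = "\<lambda>\<omega>. \<lambda>j\<in>?I. pooled m X Y j \<omega>"
  have X: "indep_vars (\<lambda>_. borel) X {1..m}" "\<And>j x. j \<in> {1..m} \<Longrightarrow> cdf (distr M borel (X j)) x = F x"
    and Y: "indep_vars (\<lambda>_. borel) Y {1..n}" "\<And>j x. j \<in> {1..n} \<Longrightarrow> cdf (distr M borel (Y j)) x = F x"
    using assms(4,6) H0 unfolding random_sample_def by auto
  define \<mu> where "\<mu> = distr M borel (X 1)"
  have law: "real_distribution (distr M borel V)" if "random_variable borel V" for V
    using that by (intro real_distribution.intro prob_space_distr real_distribution_axioms.intro) auto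
  have rvX: "random_variable borel (X j)" if "j \<in> {1..m}" for j
    using X(1) that unfolding indep_vars_def by blast
  have rvY: "random_variable borel (Y j)" if "j \<in> {1..n}" for j
    using Y(1) that unfolding indep_vars_def by blast
  have one: "1 \<in> {1..m}" using assms(2) by simp
  interpret mu: real_distribution \<mu> unfolding \<mu>_def by (rule law[OF rvX[OF one]])
  have cdf_mu: "cdf \<mu> = F" using X(2)[OF one] by (auto simp: \<mu>_def)
  have lawX: "distr M borel (X j) = \<mu>" if "j \<in> {1..m}" for j
    using that X(2) cdf_mu by (intro cdf_unique law rvX mu.real_distribution_axioms) auto
  have lawY: "distr M borel (Y j) = \<mu>" if "j \<in> {1..n}" for j
    using that Y(2) cdf_mu by (intro cdf_unique law rvY mu.real_distribution_axioms) auto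
  \<comment> \<open>Under the null hypothesis all observations have the law \<open>\<mu>\<close>, which is diffuse.\<close>
  have atomless: "emeasure \<mu> {x} = 0" for x
    using mu.isCont_cdf[of x] isCont_abs_continuous_df[OF assms(5), of x] cdf_mu
    by (simp add: mu.emeasure_eq_measure)
  have sets_mu: "sets \<mu> = sets borel" by (simp add: \<mu>_def)
  let ?N = "PiM ?I (\<lambda>_. \<mu>)"
  note pooled = distr_pooled[OF assms(1,2,3) X(1) lawX Y(1) lawY assms(8)]
  let ?R = "\<lambda>z. rank_event z {1..m} {m + 1..m + n} (m - s - 1) r k i"
  have N_sets: "sets ?N = sets (PiM ?I (\<lambda>_. borel))"
    using sets_mu by (intro sets_PiM_cong) auto
  then have N_space: "space ?N = space (PiM ?I (\<lambda>_. borel))" by (rule sets_eq_imp_space_eq)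
  have Z: "?Z \<in> measurable M ?N"
    using pooled(2) by (simp only: measurable_cong_sets[OF refl N_sets])
  have N: "?N = distr M ?N ?Z"
    using pooled(1) distr_cong[OF refl N_sets, of M ?Z ?Z] by (simp only:)
  have R: "{z \<in> space ?N. ?R z} \<in> sets ?N"
    by (rule measurable_rank_event[OF N_sets]) auto
  have "AE z in distr M ?N ?Z. inj_on z ?I"
    unfolding N[symmetric] by (rule AE_PiM_inj_on[OF mu.prob_space_axioms sets_mu atomless]) simp
  then have "AE \<omega> in M. inj_on (?Z \<omega>) ?I" by (rule AE_distrD[OF Z])
  then have "AE \<omega> in M. ?R (?Z \<omega>) \<longleftrightarrow> exceedance m X n Y s \<omega> = k \<and> precedence m X n Y r \<omega> = i"
    by (rule eventually_mono) (rule rank_event_pooled_iff[OF assms(9,10)])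
  moreover have "{\<omega> \<in> space M. exceedance m X n Y s \<omega> = k \<and> precedence m X n Y r \<omega> = i} \<in> sets M"
    using rvX rvY assms(9,10) by (rule sets_exceedance_precedence)
  ultimately have "measure M {\<omega> \<in> space M. exceedance m X n Y s \<omega> = k \<and> precedence m X n Y r \<omega> = i}
      = measure M (?Z -` {z \<in> space ?N. ?R z} \<inter> space M)"
    using measurable_sets[OF Z R] measurable_space[OF Z]
    by (intro finite_measure_eq_AE) (auto elim!: eventually_mono)
  also have "\<dots> = measure ?N {z \<in> space ?N. ?R z}"
    by (subst (2) N) (rule measure_distr[OF Z R, symmetric])
  also have "\<dots> = real (if i \<le> m - s - 1 \<and> k \<le> n - r - 1 then
         ((s + k) choose s) * ((r + i) choose r) * ((m + n - s - r - i - k - 2) choose (n - r - k - 1))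
       else if m - s \<le> i \<and> i \<le> m \<and> n - r \<le> k \<and> k \<le> n then
         ((m + n - r - i - 1) choose (n - r - 1)) * ((m + n - s - k - 1) choose (m - s - 1))
           * ((k + i + s + r - (m + n)) choose (k + r - n))
       else 0) / real ((m + n) choose n)"
    by (rule prob_rank_event_eq_count[OF mu.prob_space_axioms sets_mu atomless])
       (rule card_rank_event; use assms(9,10) in simp)
  finally show "measure M {\<omega> \<in> space M. exceedance m X n Y s \<omega> = k \<and> precedence m X n Y r \<omega> = i} =
      (if 0 \<le> i \<and> i \<le> m - s - 1 \<and> 0 \<le> k \<and> k \<le> n - r - 1 then
         real ((s + k) choose s) * real ((r + i) choose r) / real ((m + n) choose n)
           * real ((m + n - s - r - i - k - 2) choose (n - r - k - 1))
       else if m - s \<le> i \<and> i \<le> m \<and> n - r \<le> k \<and> k \<le> n then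
         real ((m + n - r - i - 1) choose (n - r - 1))
           * real ((m + n - s - k - 1) choose (m - s - 1)) / real ((m + n) choose n)
           * real ((k + i + s + r - (m + n)) choose (k + r - n))
       else 0)"
    by (simp only: of_nat_mult of_nat_0 le0 simp_thms times_divide_eq_left div_0 if_distrib[of real]
        if_distrib[of "\<lambda>u. u / real ((m + n) choose n)"] cong: if_cong)
qed

end
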